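(* Let $T$ be a tree of order $n\ge 4$ that is not isomorphic to the star $K_{1,n-1}$. Then $\gamma_{tc}(M(T))\le 2n-4$.
   Context: All graphs are finite, simple and undirected. For a graph $H$, a set $D\subseteq V(H)$ is a total dominating set if every vertex of $H$ has a neighbor in $D$. A set $D\subseteq V(H)$ is a total outer-connected dominating set of $H$ if $D$ is a total dominating set and the induced subgraph $H[V(H)\setminus D]$ is connected; $\gamma_{tc}(H)$ denotes the minimum cardinality of a total outer-connected dominating set of $H$. The middle graph $M(G)$ of a graph $G$ has vertex set $V(G)\cup E(G)$, where two elements $x,y$ are adjacent iff either $x,y\in E(G)$ are edges of $G$ sharing an endpoint, or one of them is a vertex of $G$ and the other is an edge of $G$ incident to it. *)

theory Defs
  imports "Graph_Theory.Graph_Theory"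
begin

text \<open>
  Finite simple undirected graphs are the symmetric digraphs of the locale \<^locale>\<open>graph\<close>; an
  undirected edge \<open>{u, v}\<close> is a pair of opposite arcs. For such digraphs \<^const>\<open>tree\<close> is too
  strong, since \<^const>\<open>pre_digraph.cycle\<close> counts the closed walk \<open>u, v, u\<close> along a single edge as
  a cycle. In a simple graph the undirected cycles are exactly the cycles of length at least 3.
\<close>

definition undirected_tree :: "('a, 'b) pre_digraph \<Rightarrow> bool" where
  "undirected_tree G \<longleftrightarrow>
     graph G \<and> connected G \<and> \<not> (\<exists>p. pre_digraph.cycle G p \<and> 3 \<le> length p)"

definition edges :: "('a, 'b) pre_digraph \<Rightarrow> 'a set set" where
  "edges G = {{u, v} | u v. u \<rightarrow>\<^bsub>G\<^esub> v}"

definition middle_adj :: "('a + 'a set) \<Rightarrow> ('a + 'a set) \<Rightarrow> bool" where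
  "middle_adj x y \<longleftrightarrow>
     (\<exists>e f. x = Inr e \<and> y = Inr f \<and> e \<noteq> f \<and> e \<inter> f \<noteq> {}) \<or>
     (\<exists>v e. v \<in> e \<and> (x = Inl v \<and> y = Inr e \<or> x = Inr e \<and> y = Inl v))"

definition middle_graph ::
  "('a, 'b) pre_digraph \<Rightarrow> ('a + 'a set, ('a + 'a set) \<times> ('a + 'a set)) pre_digraph" where
  "middle_graph G =
     (let V = Inl ` verts G \<union> Inr ` edges G
      in with_proj \<lparr>pverts = V, parcs = {(x, y). x \<in> V \<and> y \<in> V \<and> middle_adj x y}\<rparr>)"

lemma graph_middle_graph:
  assumes "graph G"
  shows "graph (middle_graph G)"
proof -
  interpret graph G by fact
  let ?V = "Inl ` verts G \<union> Inr ` edges G"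
  have "edges G \<subseteq> Pow (verts G)"
    by (auto simp: edges_def)
  then have "finite ?V"
    by (simp add: finite_subset)
  moreover from this have "finite {(x, y). x \<in> ?V \<and> y \<in> ?V \<and> middle_adj x y}"
    by (rule_tac finite_subset[of _ "?V \<times> ?V"]) auto
  ultimately show ?thesis
    unfolding middle_graph_def Let_def
    by unfold_locales
      (auto simp: middle_adj_def arc_to_ends_def symmetric_def arcs_ends_def sym_def)
qed

definition total_dominating_set :: "('a, 'b) pre_digraph \<Rightarrow> 'a set \<Rightarrow> bool" where
  "total_dominating_set H D \<longleftrightarrow> D \<subseteq> verts H \<and> (\<forall>v \<in> verts H. \<exists>u \<in> D. v \<rightarrow>\<^bsub>H\<^esub> u)"

text \<open>
  \<^const>\<open>connected\<close> holds only for graphs with at least one vertex, so \<open>D = verts H\<close> is excluded.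
\<close>

definition total_outer_connected_dominating_set :: "('a, 'b) pre_digraph \<Rightarrow> 'a set \<Rightarrow> bool" where
  "total_outer_connected_dominating_set H D \<longleftrightarrow>
     total_dominating_set H D \<and> connected (H \<restriction> (verts H - D))"

definition gamma_tc :: "('a, 'b) pre_digraph \<Rightarrow> nat" where
  "gamma_tc H = (LEAST k. \<exists>D. total_outer_connected_dominating_set H D \<and> card D = k)"

end

theory Submission
  imports Defs
begin

text \<open>
  If every edge of \<open>T\<close> had an end of degree one, then \<open>T\<close> would be a star, so \<open>T\<close> has an edge
  \<open>bc\<close> and further edges \<open>ab\<close> and \<open>cd\<close>. The set \<open>{b, bc, c}\<close> induces a path in \<open>M(T)\<close>, and its
  complement dominates totally: \<open>b\<close> and \<open>bc\<close> are adjacent to \<open>ab\<close>, \<open>c\<close> is adjacent to \<open>cd\<close>, any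
  other vertex is adjacent to an edge different from \<open>bc\<close>, and any other edge has an end outside
  \<open>{b, c}\<close>. As \<open>T\<close> has at most \<open>n - 1\<close> edges, this complement has at most \<open>2n - 1 - 3\<close> elements.
\<close>

section \<open>Edge count of acyclic graphs\<close>

text \<open>Longest paths are handled below as vertex lists, whereas \<open>cycle\<close> speaks of
  arc lists; choosing an arc for each step connects the two views.\<close>

lemma (in wf_digraph) vwalk_imp_awalk:
  assumes "vwalk xs G"
  shows "\<exists>p. awalk (hd xs) p (last xs) \<and> awalk_verts (hd xs) p = xs"
  using assms
proof (induction xs rule: vwalk_induct)
  case (Base u)
  then show ?case by (intro exI[of _ "[]"]) (auto simp: awalk_Nil_iff)
next
  case (Cons u v es)
  then obtain p where p: "awalk v p (last (v # es))" "awalk_verts v p = v # es"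
    by auto
  from Cons(1) obtain e where "e \<in> arcs G" "tail G e = u" "head G e = v"
    by auto
  with p show ?case by (intro exI[of _ "e # p"]) (auto simp: awalk_Cons_iff)
qed

context graph
begin

text \<open>The first vertex of a longest path inside \<open>S\<close> works: by maximality its
  neighbours in \<open>S\<close> lie on the path, and one beyond the second vertex would close a
  cycle.\<close>

lemma ex_vertex_le_one_neighbour:
  assumes acyclic: "\<not> (\<exists>p. cycle p \<and> 3 \<le> length p)"
    and S: "S \<subseteq> verts G" "S \<noteq> {}"
  obtains v where "v \<in> S" "\<And>u w. \<lbrakk>u \<in> S; w \<in> S; v \<rightarrow> u; v \<rightarrow> w\<rbrakk> \<Longrightarrow> u = w"
proof -
  have fin: "finite S"
    using S finite_verts finite_subset by blast
  define P where "P p \<longleftrightarrow> vpath p G \<and> set p \<subseteq> S" for p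
  from S obtain s where "s \<in> S" by blast
  then have "P [s]" using S by (auto simp: P_def vpath_def)
  moreover have "length p < Suc (card S)" if "P p" for p
    using that card_mono[OF fin, of "set p"] by (auto simp: P_def vpath_def distinct_card)
  ultimately obtain p where p: "P p" and longest: "\<And>q. P q \<Longrightarrow> length q \<le> length p"
    using ex_has_greatest_nat[of P "[s]" length] by metis
  from p obtain v q where vq: "p = v # q"
    by (cases p) (auto simp: P_def vpath_def vwalk_def)
  have "q \<noteq> [] \<and> u = hd q" if u: "u \<in> S" "v \<rightarrow> u" for u
  proof -
    have uv: "u \<rightarrow> v"
      using u sym_arcs by (blast intro: arcs_ends_symmetric)
    have "u \<in> set p"
    proof (rule ccontr)
      assume "u \<notin> set p"
      \<comment> \<open>Prepending \<open>u\<close> gives a longer path inside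
        \<open>S\<close>.\<close>
      then have "P (u # p)"
        using p uv u S by (auto simp: P_def vpath_def vq)
      then show False using longest by fastforce
    qed
    then have "u \<in> set q" using u adj_not_same by (auto simp: vq)
    then obtain q1 q2 where q: "q = q1 @ u # q2" by (meson split_list)
    have "q1 = []"
    proof (rule ccontr)
      assume q1: "q1 \<noteq> []"
      \<comment> \<open>The initial piece of the path up to \<open>u\<close>, closed by the edge
        between \<open>u\<close> and \<open>v\<close>. It has \<open>length q1 + 2\<close> arcs, so
        a nonempty \<open>q1\<close> gives the forbidden length of at least 3.\<close>
      let ?c = "u # v # q1 @ [u]"
      have "vwalk p G" using p by (auto simp: P_def vpath_def)
      then have "vwalk ((v # q1 @ [u]) @ q2) G" by (simp add: vq q)
      then have "vwalk (v # q1 @ [u]) G"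
        by (rule vwalkI_append_l[rotated]) simp
      then have "vwalk ?c G" using uv by simp
      then obtain c where c: "awalk u c u" "awalk_verts u c = ?c"
        using vwalk_imp_awalk[of ?c] by auto
      then have len: "length c = length q1 + 2"
        using length_awalk_verts[of u c] by simp
      moreover have "distinct (tl ?c)"
        using p by (auto simp: P_def vpath_def vq q)
      ultimately have "cycle c" using c by (auto simp: cycle_def)
      moreover have "3 \<le> length c" using len q1 by (cases q1) auto
      ultimately show False using acyclic by blast
    qed
    then show ?thesis using q by simp
  qed
  moreover have "v \<in> S" using p by (simp add: P_def vq)
  ultimately show ?thesis using that by metis
qed

lemma finite_edges: "finite (edges G)"
proof -
  have "edges G \<subseteq> Pow (verts G)" by (auto simp: edges_def)
  then show ?thesis by (simp add: finite_subset)
qed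

text \<open>Removing a vertex with at most one neighbour in \<open>S\<close> destroys at most one
  edge inside \<open>S\<close>. Counting inside vertex subsets keeps the graph fixed during the
  induction.\<close>

lemma acyclic_card_edges_less:
  assumes acyclic: "\<not> (\<exists>p. cycle p \<and> 3 \<le> length p)"
    and S: "S \<subseteq> verts G" "S \<noteq> {}"
  shows "card {e \<in> edges G. e \<subseteq> S} < card S"
proof -
  have "finite S" using S finite_verts finite_subset by blast
  then show ?thesis using S
  proof (induction S rule: finite_psubset_induct)
    case (psubset S)
    obtain v where v: "v \<in> S" "\<And>u w. \<lbrakk>u \<in> S; w \<in> S; v \<rightarrow> u; v \<rightarrow> w\<rbrakk> \<Longrightarrow> u = w"
      using ex_vertex_le_one_neighbour[OF acyclic psubset.prems] by blast
    let ?E = "\<lambda>S. {e \<in> edges G. e \<subseteq> S}"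
    let ?F = "{e \<in> edges G. e \<subseteq> S \<and> v \<in> e}"
    \<comment> \<open>By symmetry each edge at \<open>v\<close> can be read as starting there, so
      that the uniqueness of the neighbour applies.\<close>
    have F: "\<exists>u \<in> S. v \<rightarrow> u \<and> e = {v, u}" if "e \<in> ?F" for e
      using that sym_arcs by (auto simp: edges_def intro: arcs_ends_symmetric)
    have "e = f" if "e \<in> ?F" "f \<in> ?F" for e f
      using F[OF that(1)] F[OF that(2)] v(2) by blast
    then have F1: "card ?F \<le> Suc 0"
      by (subst card_le_Suc0_iff_eq) (auto simp: finite_edges)
    \<comment> \<open>A singleton is treated apart, since the induction hypothesis needs
      \<open>S - {v}\<close> to be nonempty.\<close>
    show ?case
    proof (cases "S = {v}")
      case True
      then have "?E S = {}"
        using adj_not_same by (auto simp: edges_def)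
      then show ?thesis using True by simp
    next
      case False
      have "card (?E S) \<le> card (?E (S - {v})) + card ?F"
      proof -
        have "?E S = ?E (S - {v}) \<union> ?F" by auto
        then show ?thesis by (simp only: card_Un_le)
      qed
      moreover have "card (?E (S - {v})) < card (S - {v})"
        using psubset.prems False v(1) by (intro psubset.IH) auto
      moreover have "card (S - {v}) < card S"
        using psubset.hyps v(1) by (rule card_Diff1_less)
      ultimately show ?thesis using F1 by linarith
    qed
  qed
qed

section \<open>Inner edges of connected graphs that are not stars\<close>

text \<open>Otherwise every edge has an end of degree one; the other end of one such edge is then
  adjacent to all vertices, and the graph is a star centred there.\<close>

lemma connected_non_star_ex_inner_edge:
  assumes con: "connected G" and card: "2 \<le> card (verts G)"
    and non_star: "\<not> complete_bipartite_digraph 1 (card (verts G) - 1) G"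
  obtains a b c d where "a \<rightarrow> b" "b \<rightarrow> c" "c \<rightarrow> d" "a \<noteq> c" "b \<noteq> d"
proof (rule ccontr)
  assume "\<not> thesis"
  note no_inner_edge = this that
  have pendant: "a = c \<or> b = d" if "a \<rightarrow> b" "b \<rightarrow> c" "c \<rightarrow> d" for a b c d
    using that no_inner_edge by blast
  have sym: "v \<rightarrow> u" if "u \<rightarrow> v" for u v
    using that sym_arcs by (blast intro: arcs_ends_symmetric)
  have reach: "u \<rightarrow>\<^sup>* v" if "u \<in> verts G" "v \<in> verts G" for u v
    using symmetric_connected_imp_strongly_connected[OF sym_arcs con] that by auto
  have "\<exists>u v. u \<rightarrow> v"
  proof -
    obtain u v where "u \<in> verts G" "v \<in> verts G" "u \<noteq> v"
      using card by (metis card_le_Suc0_iff_eq finite_verts not_less_eq_eq numeral_2_eq_2)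
    with reach show ?thesis
      by (meson converse_reachable_cases)
  qed
  \<comment> \<open>By \<open>pendant\<close>, one end of any edge has no further neighbour. That
    end is \<open>v\<close>; the other, \<open>c\<close>, becomes the centre.\<close>
  then obtain c v where cv: "c \<rightarrow> v" "\<And>w. v \<rightarrow> w \<Longrightarrow> w = c"
    using pendant sym by metis
  \<comment> \<open>The walk \<open>v\<close>, \<open>c\<close>, \<open>w\<close>, \<open>x\<close>
    forces \<open>v = w\<close> or \<open>c = x\<close>, and in the first case \<open>x\<close> is a
    neighbour of \<open>v\<close>.\<close>
  have leaf: "x = c" if "c \<rightarrow> w" "w \<rightarrow> x" for w x
    using pendant[of v c w x] that cv sym by metis
  have nbr: "x = c \<or> c \<rightarrow> x" if "x \<in> verts G" for x
  proof -
    have "c \<rightarrow>\<^sup>* x" using reach that cv adj_in_verts by blast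
    \<comment> \<open>A walk from \<open>c\<close> never leaves \<open>c\<close> and its
      neighbours.\<close>
    then show ?thesis
      by (induction rule: reachable_induct) (auto dest: leaf)
  qed
  have ends: "u \<rightarrow> w \<longleftrightarrow> u \<in> verts G \<and> w \<in> verts G \<and> u \<noteq> w \<and> (u = c \<or> w = c)" for u w
    using nbr[of u] nbr[of w] leaf[of u w] sym adj_in_verts[of u w] adj_not_same by metis
  have "c \<in> verts G" using cv adj_in_verts by blast
  have "complete_bipartite_digraph 1 (card (verts G) - 1) G"
    unfolding complete_bipartite_digraph_def
  proof (intro conjI exI)
    show "graph G" by unfold_locales
    show "verts G = {c} \<union> (verts G - {c})"
      using \<open>c \<in> verts G\<close> by blast
    show "card (verts G - {c}) = card (verts G) - 1"
      using \<open>c \<in> verts G\<close> by simp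
    show "arcs_ends G = {c} \<times> (verts G - {c}) \<union> (verts G - {c}) \<times> {c}"
      using ends \<open>c \<in> verts G\<close> by auto
  qed auto
  then show False using non_star by blast
qed

end

section \<open>Total outer-connected domination in the middle graph\<close>

lemma verts_middle_graph: "verts (middle_graph G) = Inl ` verts G \<union> Inr ` edges G"
  by (simp add: middle_graph_def Let_def)

lemma dominates_middle_graph_iff:
  "x \<rightarrow>\<^bsub>middle_graph G\<^esub> y \<longleftrightarrow>
     x \<in> verts (middle_graph G) \<and> y \<in> verts (middle_graph G) \<and> middle_adj x y"
  by (simp add: middle_graph_def Let_def)

lemma (in graph) card_verts_middle_graph:
  "card (verts (middle_graph G)) = card (verts G) + card (edges G)"
  unfolding verts_middle_graph
  by (subst card_Un_disjoint) (auto simp: card_image finite_edges)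

lemma dominates_induce_subgraph_iff:
  "u \<rightarrow>\<^bsub>G \<restriction> S\<^esub> v \<longleftrightarrow> u \<rightarrow>\<^bsub>G\<^esub> v \<and> u \<in> S \<and> v \<in> S"
  by (auto simp: arcs_ends_conv)

lemma (in wf_digraph) connected_induce_subgraph_hub:
  assumes "symmetric G" "c \<in> S" "S \<subseteq> verts G" "\<And>v. v \<in> S - {c} \<Longrightarrow> c \<rightarrow> v"
  shows "connected (G \<restriction> S)"
proof -
  interpret S: wf_digraph "G \<restriction> S" by blast
  have from_hub: "c \<rightarrow>\<^sup>*\<^bsub>G \<restriction> S\<^esub> v" if "v \<in> S" for v
    using assms that by (cases "v = c") (auto simp: dominates_induce_subgraph_iff)
  have to_hub: "v \<rightarrow>\<^sup>*\<^bsub>G \<restriction> S\<^esub> c" if "v \<in> S" for v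
    using from_hub[OF that] assms by (auto intro: symmetric_reachable induced_graph_imp_symmetric)
  show ?thesis
  proof (rule S.connectedI)
    show "verts (G \<restriction> S) \<noteq> {}" using assms(2) by auto
    fix u v assume "u \<in> verts (G \<restriction> S)" "v \<in> verts (G \<restriction> S)"
    then have "u \<rightarrow>\<^sup>*\<^bsub>G \<restriction> S\<^esub> v"
      using from_hub to_hub by (auto intro: S.reachable_trans)
    \<comment> \<open>\<open>connected\<close> refers to reachability in the symmetric
      closure.\<close>
    then show "u \<rightarrow>\<^sup>*\<^bsub>mk_symmetric (G \<restriction> S)\<^esub> v"
      by (rule S.reachable_mk_symmetricI)
  qed
qed

text \<open>The edges \<open>{a, b}\<close> and \<open>{c, d}\<close> serve as dominators at
  \<open>b\<close> and \<open>c\<close> because they differ from \<open>{b, c}\<close>;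
  \<open>a\<close> and \<open>d\<close> may coincide.\<close>

lemma (in graph) total_outer_connected_dominating_set_middle_graph:
  assumes path: "a \<rightarrow> b" "b \<rightarrow> c" "c \<rightarrow> d" "a \<noteq> c" "b \<noteq> d" and con: "connected G"
  defines "C \<equiv> {Inl b, Inr {b, c}, Inl c}"
  shows "total_outer_connected_dominating_set (middle_graph G) (verts (middle_graph G) - C)"
proof -
  let ?M = "middle_graph G"
  have "graph G" by unfold_locales
  then interpret M: graph ?M by (rule graph_middle_graph)
  have neq: "a \<noteq> b" "b \<noteq> c" "c \<noteq> d"
    using path adj_not_same by auto
  have verts: "a \<in> verts G" "b \<in> verts G" "c \<in> verts G" "d \<in> verts G"
    using path adj_in_verts by auto
  have edges: "{a, b} \<in> edges G" "{b, c} \<in> edges G" "{c, d} \<in> edges G"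
    using path by (auto simp: edges_def)
  have C: "C \<subseteq> verts ?M"
    using verts edges by (auto simp: C_def verts_middle_graph)
  have "\<exists>u \<in> verts ?M - C. x \<rightarrow>\<^bsub>?M\<^esub> u" if x: "x \<in> verts ?M" for x
  proof -
    have "\<exists>u \<in> verts ?M - C. middle_adj x u"
    proof (cases x)
      case (Inl v)
      then have v: "v \<in> verts G" using x by (auto simp: verts_middle_graph)
      have "\<exists>e \<in> edges G. v \<in> e \<and> e \<noteq> {b, c}"
      proof -
        consider "v = b" | "v = c" | "v \<noteq> b" "v \<noteq> c" by blast
        then show ?thesis
        proof cases
          case 1
          then show ?thesis using edges(1) path neq by (intro bexI[of _ "{a, b}"]) auto
        next
          case 2
          then show ?thesis using edges(3) path neq by (intro bexI[of _ "{c, d}"]) auto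
        next
          case 3
          \<comment> \<open>The first step of a walk from \<open>v\<close> to \<open>b\<close>
            supplies an edge at \<open>v\<close>, which differs from \<open>{b, c}\<close> because
            \<open>v\<close> lies outside that set.\<close>
          have "v \<rightarrow>\<^sup>* b"
            using symmetric_connected_imp_strongly_connected[OF sym_arcs con] v verts by auto
          then obtain w where "v \<rightarrow> w"
            using 3 by (meson converse_reachable_cases)
          then show ?thesis using 3 by (intro bexI[of _ "{v, w}"]) (auto simp: edges_def)
        qed
      qed
      then obtain e where "e \<in> edges G" "v \<in> e" "e \<noteq> {b, c}" by blast
      then show ?thesis
        by (intro bexI[of _ "Inr e"]) (auto simp: Inl C_def verts_middle_graph middle_adj_def)
    next
      case (Inr e)
      then have e: "e \<in> edges G" using x by (auto simp: verts_middle_graph)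
      show ?thesis
      proof (cases "e = {b, c}")
        case True
        have "{a, b} \<noteq> {b, c}" using path neq by auto
        then show ?thesis using edges(1)
          by (intro bexI[of _ "Inr {a, b}"])
            (auto simp: Inr True C_def verts_middle_graph middle_adj_def)
      next
        case False
        from e obtain u w where uw: "e = {u, w}" "u \<rightarrow> w" by (auto simp: edges_def)
        then have "u \<noteq> w" "u \<in> verts G" "w \<in> verts G"
          using adj_not_same adj_in_verts by auto
        then obtain v where "v \<in> e" "v \<noteq> b" "v \<noteq> c" "v \<in> verts G"
          using False uw by auto
        then show ?thesis
          by (intro bexI[of _ "Inl v"]) (auto simp: Inr C_def verts_middle_graph middle_adj_def)
      qed
    qed
    then show ?thesis using x by (auto simp: dominates_middle_graph_iff)
  qed
  then have "total_dominating_set ?M (verts ?M - C)"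
    by (auto simp: total_dominating_set_def)
  moreover have "connected (?M \<restriction> C)"
  \<comment> \<open>The edge \<open>{b, c}\<close> is the hub, being adjacent to both of its
    ends.\<close>
  proof (rule M.connected_induce_subgraph_hub[OF M.sym_arcs _ C])
    show "Inr {b, c} \<in> C" by (simp add: C_def)
    show "Inr {b, c} \<rightarrow>\<^bsub>?M\<^esub> v" if "v \<in> C - {Inr {b, c}}" for v
      using that C by (auto simp: dominates_middle_graph_iff C_def middle_adj_def)
  qed
  moreover have "verts ?M - (verts ?M - C) = C"
    using C by blast
  ultimately show ?thesis
    by (simp add: total_outer_connected_dominating_set_def)
qed

theorem theorem3p4:
  fixes T :: "('a, 'b) pre_digraph" and n :: nat
  assumes "undirected_tree T"
    and "card (verts T) = n"
    and "n \<ge> 4"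
    and "\<not> complete_bipartite_digraph 1 (n - 1) T"
  shows "gamma_tc (middle_graph T) \<le> 2 * n - 4"
proof -
  let ?M = "middle_graph T"
  have con: "connected T" and acyclic: "\<not> (\<exists>p. pre_digraph.cycle T p \<and> 3 \<le> length p)"
    using assms(1) by (auto simp: undirected_tree_def)
  interpret graph T using assms(1) by (simp add: undirected_tree_def)
  obtain a b c d where
    path: "a \<rightarrow>\<^bsub>T\<^esub> b" "b \<rightarrow>\<^bsub>T\<^esub> c" "c \<rightarrow>\<^bsub>T\<^esub> d" "a \<noteq> c" "b \<noteq> d"
  proof (rule connected_non_star_ex_inner_edge[OF con])
    show "2 \<le> card (verts T)" "\<not> complete_bipartite_digraph 1 (card (verts T) - 1) T"
      using assms(2-4) by simp_all
  qed blast
  let ?C = "{Inl b, Inr {b, c}, Inl c}"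
  let ?D = "verts ?M - ?C"
  have "total_outer_connected_dominating_set ?M ?D"
    using path con by (rule total_outer_connected_dominating_set_middle_graph)
  then have "gamma_tc ?M \<le> card ?D"
    unfolding gamma_tc_def by (intro Least_le) blast
  also have "card ?D \<le> 2 * n - 4"
  proof -
    have "b \<noteq> c" using path adj_not_same by auto
    then have "card ?C = 3" by simp
    moreover have "?C \<subseteq> verts ?M"
    proof -
      have "b \<in> verts T" "c \<in> verts T" "{b, c} \<in> edges T"
        using path(2) adj_in_verts[OF path(2)] by (auto simp: edges_def)
      then show ?thesis by (simp add: verts_middle_graph)
    qed
    ultimately have "card ?D = card (verts T) + card (edges T) - 3"
      by (simp add: card_Diff_subset card_verts_middle_graph)
    moreover have "card (edges T) < card (verts T)"
    proof -
      have "{e \<in> edges T. e \<subseteq> verts T} = edges T"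
        using adj_in_verts by (auto simp: edges_def)
      then show ?thesis
        using acyclic_card_edges_less[OF acyclic, of "verts T"] adj_in_verts[OF path(2)] by auto
    qed
    \<comment> \<open>With at most \<open>n - 1\<close> edges, the count is at most
      \<open>n + (n - 1) - 3\<close>.\<close>
    ultimately show ?thesis using assms(2) by linarith
  qed
  finally show ?thesis .
qed

end
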